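(* (In $\mathsf{ZFC}$.) The statement $\Delta(\mathrm{FI})$ holds; that is, there exists a function $F:\mathrm{FI}\to\omega^\omega$ such that whenever $x,y\in\mathrm{FI}$ switch, then $x\setminus y\not>^* F(y)$ or $y\setminus x\not>^* F(x)$.
   Context: A partial function is a function $x:N\to\omega$ with $N\subseteq\omega$; write $\operatorname{dom} x=N$ and identify $x$ with its graph, a subset of $\omega\times\omega$ (so $x\setminus y$ is the set difference of graphs, again a partial function). $\omega^{\subseteq\omega}$ is the set of all partial functions, and $\omega^{\subset\omega}$ the set of those whose domain is infinite and co-infinite. For a partial function $x$ and $h\in\omega^\omega$, $x>^*h$ means that $x(n)>h(n)$ for all but finitely many $n\in\operatorname{dom}x$. Two partial functions $x,y$ switch if $x\setminus y$ and $y\setminus x$ are both infinite and $x(n)=y(n)$ for all but finitely many $n\in\operatorname{dom}x\cap\operatorname{dom}y$. $\mathrm{INC}$ is the set of all $x\in\omega^{\subset\omega}$ that are increasing: whenever $m\le n$ are in $\operatorname{dom}x$, $x(m)\le x(n)$. $\mathrm{FI}$ is the set of all partial functions $x$ such that $\operatorname{dom}x$ can be partitioned into finitely many sets $S_1,\dots,S_k$ with each restriction $x\restriction S_i$ in $\mathrm{INC}$. *)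

theory Defs
  imports Main "HOL-Library.Disjoint_Sets"
begin

type_synonym pfun = "nat \<rightharpoonup> nat"

text \<open>
  Partial functions are maps; their graphs as sets of pairs are given by \<open>Map.graph\<close>.
  The set difference of graphs is again the graph of a partial function, namely of
  \<open>pf_diff x y\<close>, as the lemma \<open>graph_pf_diff\<close> confirms.
\<close>

definition pf_diff :: "pfun \<Rightarrow> pfun \<Rightarrow> pfun" where
  "pf_diff x y = (\<lambda>n. if x n = y n then None else x n)"

lemma graph_pf_diff: "Map.graph (pf_diff x y) = Map.graph x - Map.graph y"
  by (auto simp: Map.graph_def pf_diff_def split: if_splits)

definition ev_gt :: "pfun \<Rightarrow> (nat \<Rightarrow> nat) \<Rightarrow> bool" (infix \<open>>\<^sup>*\<close> 50) where
  "x >\<^sup>* h \<longleftrightarrow> finite {n \<in> dom x. \<not> the (x n) > h n}"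

definition switch :: "pfun \<Rightarrow> pfun \<Rightarrow> bool" where
  "switch x y \<longleftrightarrow>
     infinite (Map.graph (pf_diff x y)) \<and>
     infinite (Map.graph (pf_diff y x)) \<and>
     finite {n \<in> dom x \<inter> dom y. the (x n) \<noteq> the (y n)}"

definition INC :: "pfun set" where
  "INC = {x. infinite (dom x) \<and> infinite (- dom x) \<and>
             (\<forall>m \<in> dom x. \<forall>n \<in> dom x. m \<le> n \<longrightarrow> the (x m) \<le> the (x n))}"

text \<open>
  The partition of the domain may be empty, so the empty map belongs to \<open>FI\<close>.
  This has no effect on \<open>Delta FI\<close>, as the empty map switches with no partial function.
\<close>

definition FI :: "pfun set" where
  "FI = {x. \<exists>P. finite P \<and> partition_on (dom x) P \<and> (\<forall>S \<in> P. x |` S \<in> INC)}"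

text \<open>
  A function defined on \<open>A\<close> only is represented by a total one; its values
  outside \<open>A\<close> are never used.
\<close>

definition Delta :: "pfun set \<Rightarrow> bool" where
  "Delta A \<longleftrightarrow>
     (\<exists>F :: pfun \<Rightarrow> nat \<Rightarrow> nat. \<forall>x \<in> A. \<forall>y \<in> A. switch x y \<longrightarrow>
        \<not> (pf_diff x y >\<^sup>* F y) \<or> \<not> (pf_diff y x >\<^sup>* F x))"

end

theory Submission
  imports Defs "HOL-Library.Infinite_Set"
begin

text \<open>
  A finite union of increasing functions has strictly decreasing chains of bounded length only.
  Let \<open>K x\<close> be the greatest \<open>k\<close> such that infinitely many points start a decreasing chain with
  \<open>k\<close> further points, and let \<open>F x n\<close> dominate all values of \<open>x\<close> up to \<open>n\<close> as well as
  the value at the next point starting such a chain of \<open>x\<close>.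
  Suppose that \<open>F\<close> fails for \<open>x\<close> and \<open>y\<close>, where \<open>K x \<le> K y\<close>. Take a large \<open>n\<close> in
  \<open>dom x - dom y\<close> and the next \<open>m\<close> starting a chain of \<open>y\<close> with \<open>K y\<close> further points;
  then \<open>y m < x n\<close>. The chain lies in \<open>x\<close>: a point \<open>p\<close> of it outside \<open>x\<close> would satisfy
  \<open>y p > F x p \<ge> x n > y m \<ge> y p\<close>. Prefixing \<open>n\<close> gives a chain of \<open>x\<close> longer than
  \<open>K x\<close> allows for large \<open>n\<close>.
\<close>

definition desc :: "pfun \<Rightarrow> nat list \<Rightarrow> bool" where
  "desc x ms \<longleftrightarrow> set ms \<subseteq> dom x \<and> sorted_wrt (\<lambda>a b. a < b \<and> the (x b) < the (x a)) ms"

definition desc_heads :: "pfun \<Rightarrow> nat \<Rightarrow> nat set" where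
  "desc_heads x k = {m. \<exists>ms. desc x (m # ms) \<and> length ms = k}"

definition desc_rank :: "pfun \<Rightarrow> nat" where
  "desc_rank x = (GREATEST k. infinite (desc_heads x k))"

text \<open>The sum serves as a monotone upper bound for single values. Where
  \<open>x i = None\<close>, \<open>the (x i)\<close> is an unspecified natural number, which can
  only enlarge it.\<close>

definition bounding :: "pfun \<Rightarrow> nat \<Rightarrow> nat" where
  "bounding x n =
     (\<Sum>i\<le>n. the (x i)) + the (x (LEAST m. n \<le> m \<and> m \<in> desc_heads x (desc_rank x)))"

lemma desc_heads_0: "desc_heads x 0 = dom x"
  by (auto simp: desc_heads_def desc_def)

lemma desc_heads_subset_dom: "desc_heads x k \<subseteq> dom x"
  by (auto simp: desc_heads_def desc_def)

text \<open>Pigeonhole: \<open>x\<close> is nondecreasing on each block, so the points of a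
  decreasing chain lie in distinct blocks.\<close>

lemma FI_desc_bounded:
  assumes "x \<in> FI"
  obtains N where "\<And>ms. desc x ms \<Longrightarrow> length ms \<le> N"
proof -
  obtain P where P: "finite P" "partition_on (dom x) P" "\<And>S. S \<in> P \<Longrightarrow> x |` S \<in> INC"
    using assms by (auto simp: FI_def)
  have "\<exists>S. S \<in> P \<and> i \<in> S" if "i \<in> dom x" for i
    using P(2) that unfolding partition_on_def by blast
  then obtain block where block: "\<And>i. i \<in> dom x \<Longrightarrow> block i \<in> P \<and> i \<in> block i"
    by metis
  have mono: "the (x a) \<le> the (x b)"
    if "a \<in> dom x" "b \<in> dom x" "block a = block b" "a \<le> b" for a b
  proof -
    have "a \<in> dom (x |` block a)" "b \<in> dom (x |` block a)"
      using that block[of a] block[of b] by auto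
    then have "the ((x |` block a) a) \<le> the ((x |` block a) b)"
      using P(3)[of "block a"] block[OF that(1)] that(4) unfolding INC_def by blast
    then show ?thesis
      using that block[of a] block[of b] by (simp add: restrict_map_def)
  qed
  have "length ms \<le> card P" if "desc x ms" for ms
  proof -
    have "sorted_wrt (\<lambda>a b. block a \<noteq> block b) ms"
    proof (rule sorted_wrt_mono_rel)
      show "sorted_wrt (\<lambda>a b. a < b \<and> the (x b) < the (x a)) ms"
        using that by (simp add: desc_def)
      show "block a \<noteq> block b"
        if "a \<in> set ms" "b \<in> set ms" "a < b \<and> the (x b) < the (x a)" for a b
        using that \<open>desc x ms\<close> mono[of a b] by (auto simp: desc_def)
    qed
    then have "distinct (map block ms)"
      by (simp add: distinct_conv_nth sorted_wrt_iff_nth_less) (metis nat_neq_iff)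
    moreover have "set (map block ms) \<subseteq> P"
      using that block unfolding desc_def set_map by blast
    ultimately show ?thesis
      using card_mono[OF P(1)] distinct_card by (metis length_map)
  qed
  then show ?thesis
    using that by blast
qed

lemma desc_rank:
  assumes "x \<in> FI" "infinite (dom x)"
  shows infinite_desc_heads_rank: "infinite (desc_heads x (desc_rank x))"
    and infinite_desc_heads_le_rank: "infinite (desc_heads x k) \<Longrightarrow> k \<le> desc_rank x"
proof -
  obtain N where N: "\<And>ms. desc x ms \<Longrightarrow> length ms \<le> N"
    using FI_desc_bounded[OF assms(1)] by blast
  have bound: "k \<le> N" if "infinite (desc_heads x k)" for k
  proof -
    obtain m where "m \<in> desc_heads x k"
      using infinite_imp_nonempty[OF \<open>infinite (desc_heads x k)\<close>] by blast
    then show ?thesis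
      using N by (fastforce simp: desc_heads_def)
  qed
  \<comment> \<open>The greatest \<open>k\<close> exists: 0 qualifies, as its heads form all of
    \<open>dom x\<close>, and \<open>N\<close> bounds every candidate.\<close>
  show "infinite (desc_heads x (desc_rank x))"
    unfolding desc_rank_def
    by (rule GreatestI_nat[of "\<lambda>k. infinite (desc_heads x k)" 0 N])
      (use assms(2) bound in \<open>auto simp: desc_heads_0\<close>)
  show "k \<le> desc_rank x" if "infinite (desc_heads x k)"
    unfolding desc_rank_def
    by (rule Greatest_le_nat[of "\<lambda>k. infinite (desc_heads x k)" k N]) (use that bound in auto)
qed

lemma le_bounding:
  assumes "i \<le> n"
  shows "the (x i) \<le> bounding x n"
  using member_le_sum[of i "{..n}" "\<lambda>i. the (x i)"] assms by (simp add: bounding_def)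

lemma bounding_desc_head:
  assumes "x \<in> FI" "infinite (dom x)"
  obtains m where "n \<le> m" "m \<in> desc_heads x (desc_rank x)" "the (x m) \<le> bounding x n"
proof -
  let ?P = "\<lambda>m. n \<le> m \<and> m \<in> desc_heads x (desc_rank x)"
  have "\<exists>m. ?P m"
    using infinite_desc_heads_rank[OF assms] by (meson infinite_nat_iff_unbounded_le)
  then have "?P (Least ?P)"
    by (rule LeastI_ex)
  then show ?thesis
    using that[of "Least ?P"] by (simp add: bounding_def)
qed

lemma infinite_dom_pf_diff:
  assumes "infinite (Map.graph (pf_diff x y))"
  shows "infinite (dom (pf_diff x y))"
  using assms by (simp add: finite_graph_iff_finite_dom)

lemma dom_pf_diff_iff: "n \<in> dom (pf_diff x y) \<longleftrightarrow> n \<in> dom x \<and> x n \<noteq> y n"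
  by (auto simp: pf_diff_def split: if_splits)

lemma the_pf_diff: "n \<in> dom (pf_diff x y) \<Longrightarrow> the (pf_diff x y n) = the (x n)"
  by (auto simp: pf_diff_def split: if_splits)

lemma switch_sym: "switch x y \<Longrightarrow> switch y x"
  unfolding switch_def by (simp add: Int_commute eq_commute)

lemma switch_infinite_dom:
  assumes "switch x y"
  shows "infinite (dom x)"
proof -
  have "dom (pf_diff x y) \<subseteq> dom x"
    using dom_pf_diff_iff by blast
  then show ?thesis
    using assms infinite_dom_pf_diff finite_subset unfolding switch_def by blast
qed

lemma switch_not_both_ev_gt:
  assumes FI: "x \<in> FI" "y \<in> FI" and sw: "switch x y" and rank: "desc_rank x \<le> desc_rank y"
    and gt: "pf_diff x y >\<^sup>* bounding y" "pf_diff y x >\<^sup>* bounding x"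
  shows False
proof -
  define A where "A = {n \<in> dom x \<inter> dom y. the (x n) \<noteq> the (y n)}"
  define B where "B = {n \<in> dom (pf_diff x y). \<not> the (pf_diff x y n) > bounding y n}"
  define C where "C = {n \<in> dom (pf_diff y x). \<not> the (pf_diff y x n) > bounding x n}"
  define D where "D = desc_heads x (Suc (desc_rank y))"
  \<comment> \<open>The rank hypothesis enters here: \<open>Suc (desc_rank y)\<close> exceeds
    \<open>desc_rank x\<close>.\<close>
  have "finite D"
    using infinite_desc_heads_le_rank[OF FI(1) switch_infinite_dom[OF sw]] rank
    unfolding D_def by fastforce
  then have "finite (A \<union> B \<union> C \<union> D)"
    using sw gt by (simp add: switch_def ev_gt_def A_def B_def C_def)
  then obtain N where N: "\<And>n. n \<in> A \<union> B \<union> C \<union> D \<Longrightarrow> n \<le> N"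
    by (meson finite_nat_set_iff_bounded_le)
  obtain n where n: "n > N" "n \<in> dom (pf_diff x y)"
    using infinite_dom_pf_diff sw unfolding switch_def by (meson infinite_nat_iff_unbounded)
  have eq: "x p = y p" if "p \<ge> n" "p \<in> dom x" "p \<in> dom y" for p
  proof -
    have "p \<notin> A"
      using N[of p] n(1) that(1) by auto
    then show ?thesis
      using that by (auto simp: A_def)
  qed
  \<comment> \<open>Were \<open>n\<close> in \<open>dom y\<close>, \<open>eq\<close> would force
    \<open>x n = y n\<close>, contrary to the choice of \<open>n\<close>.\<close>
  have n': "n \<in> dom x" "n \<notin> dom y" "n \<notin> D" "bounding y n < the (x n)"
    using n eq[of n] N[of n] the_pf_diff[OF n(2)] by (auto simp: dom_pf_diff_iff B_def)
  obtain m where m: "n \<le> m" "m \<in> desc_heads y (desc_rank y)" "the (y m) \<le> bounding y n"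
    using bounding_desc_head[OF FI(2) switch_infinite_dom[OF switch_sym[OF sw]]] .
  then obtain ms where ms: "desc y (m # ms)" "length ms = desc_rank y"
    by (auto simp: desc_heads_def)
  \<comment> \<open>Equality is excluded because \<open>m\<close> lies in \<open>dom y\<close> and
    \<open>n\<close> does not.\<close>
  have "n < m"
    using m n'(2) desc_heads_subset_dom by (metis le_neq_implies_less subsetD)
  have chain: "n < p \<and> x p = y p \<and> p \<in> dom y \<and> the (y p) < the (x n)" if "p \<in> set (m # ms)" for p
  proof -
    have p: "m \<le> p" "the (y p) \<le> the (y m)" "p \<in> dom y"
      using that ms(1) by (auto simp: desc_def)
    have less: "the (y p) < the (x n)"
      using p(2) m(3) n'(4) by linarith
    have "p \<notin> C"
      using N[of p] n(1) m(1) p(1) by auto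
    moreover have "the (y p) \<le> bounding x p"
      using less le_bounding[of n p x] p(1) m(1) by linarith
    ultimately have "p \<notin> dom (pf_diff y x)"
      using the_pf_diff[of p y x] by (auto simp: C_def)
    then show ?thesis
      using p less \<open>n < m\<close> by (auto simp: dom_pf_diff_iff)
  qed
  \<comment> \<open>\<open>x\<close> and \<open>y\<close> agree on the chain, so its order and
    descent carry over.\<close>
  have "desc x (m # ms)"
    using ms(1) chain unfolding desc_def
    by (auto simp: dom_def elim!: sorted_wrt_mono_rel[rotated])
  then have "desc x (n # m # ms)"
    using n'(1) chain unfolding desc_def by auto
  then have "n \<in> D"
    using ms(2) unfolding D_def desc_heads_def by (auto intro!: exI[of _ "m # ms"])
  then show False
    using n'(3) by blast
qed

theorem proposition16:
  shows "Delta FI"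
  unfolding Delta_def
proof (intro exI[of _ bounding] ballI impI)
  fix x y
  assume *: "x \<in> FI" "y \<in> FI" "switch x y"
  \<comment> \<open>The claim is symmetric in \<open>x\<close> and \<open>y\<close>, so the smaller
    rank may come first.\<close>
  then show "\<not> (pf_diff x y >\<^sup>* bounding y) \<or> \<not> (pf_diff y x >\<^sup>* bounding x)"
    using switch_not_both_ev_gt switch_sym by (meson nle_le)
qed

end
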